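(* Let $T\subset\mathbb{C}$ be a triangle with vertices $A,B,C$ and $\tilde T\subset\mathbb{C}$ a triangle with vertices $\tilde A,\tilde B,\tilde C$. Let $f$ be a projective transformation of $\mathbb{R}\mathrm{P}^2$ that maps $T$ onto $\tilde T$ with $f(A)=\tilde A$, $f(B)=\tilde B$, $f(C)=\tilde C$, and that maps the circumcircle of $T$ to the circumcircle of $\tilde T$. Let $h$ be the real affine map from $T$ onto $\tilde T$ with $h(A)=\tilde A$, $h(B)=\tilde B$, $h(C)=\tilde C$. If $f$ is orientation preserving on $T$, then $$|\mu_f(P)|\le|\mu_h(P)|\quad\text{for all points }P\in T,$$ and $$\max_{P\in T}|\mu_f(P)|=|\mu_h|,$$ where $|\mu_h|$ denotes the constant value of the eccentricity of the affine map $h$.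
   Context: A projective transformation is a map $f:\mathbb{R}\mathrm{P}^2\to\mathbb{R}\mathrm{P}^2$, $[x]\mapsto[Mx]$ with $M\in \mathrm{GL}_3(\mathbb{R})$. The complement of the line at infinity $\ell_\infty=\{[x] : x_3=0\}$ is identified with $\mathbb{C}$ via $z=x+iy\leftrightarrow[(x,y,1)]$. For a real differentiable map $f$ from an open subset of $\mathbb{C}$ to $\mathbb{C}$ with nowhere vanishing derivative, the Beltrami coefficient is $\mu_f=f_{\bar z}/f_z$, where $f_z=\frac12(f_x-if_y)$ and $f_{\bar z}=\frac12(f_x+if_y)$. Its modulus $|\mu_f|\in[0,\infty]$ is called the eccentricity; it is $\infty$ where $f_z=0$. The eccentricity of a real affine map is constant. "Triangle" means closed triangular region (nondegenerate). *)

theory Defs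
  imports "HOL-Analysis.Analysis"
begin

section \<open>The real projective plane\<close>

definition proj_rel :: "real^3 \<Rightarrow> real^3 \<Rightarrow> bool" where
  "proj_rel x y \<longleftrightarrow> x \<noteq> 0 \<and> (\<exists>c::real. c \<noteq> 0 \<and> y = c *\<^sub>R x)"

lemma part_equivp_proj_rel: "part_equivp proj_rel"
proof (rule part_equivpI)
  show "\<exists>x. proj_rel x x"
    by (rule exI[of _ "axis 1 1"], auto simp: proj_rel_def axis_eq_0_iff intro!: exI[of _ 1])
  show "symp proj_rel"
  proof (rule sympI)
    fix x y assume "proj_rel x y"
    then obtain c where "x \<noteq> 0" "c \<noteq> 0" "y = c *\<^sub>R x" by (auto simp: proj_rel_def)
    then show "proj_rel y x"
      by (auto simp: proj_rel_def intro!: exI[of _ "inverse c"])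
  qed
  show "transp proj_rel"
  proof (rule transpI)
    fix x y z assume "proj_rel x y" "proj_rel y z"
    then obtain c d where "x \<noteq> 0" "c \<noteq> 0" "y = c *\<^sub>R x" "d \<noteq> 0" "z = d *\<^sub>R y"
      by (auto simp: proj_rel_def)
    then show "proj_rel x z"
      by (auto simp: proj_rel_def intro!: exI[of _ "d * c"])
  qed
qed

text \<open>For \<open>x \<noteq> 0\<close> the projective point \<open>[x]\<close> is \<open>abs_rp2 x\<close>; \<open>abs_rp2 0\<close> is meaningless.\<close>

quotient_type rp2 = "real^3" / partial: proj_rel
  by (rule part_equivp_proj_rel)

lemma abs_rp2_eq_iff:
  assumes "x \<noteq> 0" "y \<noteq> 0"
  shows "abs_rp2 x = abs_rp2 y \<longleftrightarrow> (\<exists>c::real. c \<noteq> 0 \<and> y = c *\<^sub>R x)"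
proof -
  have "proj_rel x x" "proj_rel y y"
    using assms by (auto simp: proj_rel_def intro!: exI[of _ 1])
  then have "abs_rp2 x = abs_rp2 y \<longleftrightarrow> proj_rel x y"
    using Quotient_rel[OF Quotient_rp2, of x y] by blast
  then show ?thesis
    using assms by (simp add: proj_rel_def)
qed

lemma rp2_cases:
  obtains x where "x \<noteq> 0" "p = abs_rp2 x"
proof -
  obtain x where "proj_rel x x" "p = abs_rp2 x"
    using Quotient_abs_rep[OF Quotient_rp2] Quotient_rep_reflp[OF Quotient_rp2] by metis
  then show thesis
    using that by (auto simp: proj_rel_def)
qed

definition line_at_infinity :: "rp2 set" where
  "line_at_infinity = {abs_rp2 x | x. x \<noteq> 0 \<and> x $ 3 = 0}"

definition projective_transformation :: "(rp2 \<Rightarrow> rp2) \<Rightarrow> bool" where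
  "projective_transformation f \<longleftrightarrow>
     (\<exists>M :: real^3^3. invertible M \<and> (\<forall>x. x \<noteq> 0 \<longrightarrow> f (abs_rp2 x) = abs_rp2 (M *v x)))"

definition rp2_of_complex :: "complex \<Rightarrow> rp2" where
  "rp2_of_complex z = abs_rp2 (vector [Re z, Im z, 1])"

text \<open>The inverse identification; by the two lemmas that follow it is meaningful exactly off the
  line at infinity.\<close>

definition complex_of_rp2 :: "rp2 \<Rightarrow> complex" where
  "complex_of_rp2 = inv rp2_of_complex"

lemma vector3_last_1_nonzero [simp]: "vector [a, b, 1] \<noteq> (0 :: real^3)"
  by (metis vector_3(3) zero_index zero_neq_one)

lemma inj_rp2_of_complex: "inj rp2_of_complex"
proof (rule injI)
  fix z w assume "rp2_of_complex z = rp2_of_complex w"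
  then obtain c :: real where c: "vector [Re w, Im w, 1] = c *\<^sub>R (vector [Re z, Im z, 1] :: real^3)"
    by (auto simp: rp2_of_complex_def abs_rp2_eq_iff)
  have "vector [Re w, Im w, 1] $ i = c * (vector [Re z, Im z, 1] :: real^3) $ i" for i :: 3
    using c by simp
  from this[of 1] this[of 2] this[of 3] show "z = w"
    by (simp add: vector_3 complex_eq_iff)
qed

lemma range_rp2_of_complex: "range rp2_of_complex = - line_at_infinity"
proof (intro equalityI subsetI)
  fix p assume "p \<in> range rp2_of_complex"
  then obtain z where z: "p = abs_rp2 (vector [Re z, Im z, 1])"
    by (auto simp: rp2_of_complex_def)
  show "p \<in> - line_at_infinity"
  proof
    assume "p \<in> line_at_infinity"
    then obtain x where x: "p = abs_rp2 x" "x \<noteq> 0" "x $ 3 = 0"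
      by (auto simp: line_at_infinity_def)
    then obtain c :: real where "vector [Re z, Im z, 1] = c *\<^sub>R x"
      using z abs_rp2_eq_iff[of x "vector [Re z, Im z, 1]"] by auto
    then have "(vector [Re z, Im z, 1] :: real^3) $ 3 = c * x $ 3"
      by simp
    with x show False by (simp add: vector_3)
  qed
next
  fix p assume p: "p \<in> - line_at_infinity"
  obtain x where x: "x \<noteq> 0" "p = abs_rp2 x" by (rule rp2_cases)
  with p have x3: "x $ 3 \<noteq> 0" by (auto simp: line_at_infinity_def)
  define z where "z = Complex (x $ 1 / x $ 3) (x $ 2 / x $ 3)"
  have "x = (x $ 3) *\<^sub>R vector [Re z, Im z, 1]"
    using x3 by (simp add: vec_eq_iff forall_3 vector_3 z_def)
  then have "abs_rp2 (vector [Re z, Im z, 1]) = abs_rp2 x"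
    using x x3 by (auto simp: abs_rp2_eq_iff)
  then show "p \<in> range rp2_of_complex"
    using x by (metis rangeI rp2_of_complex_def)
qed

text \<open>A self-map of the projective plane read in the affine chart \<open>\<complex>\<close>.  The values at points that are
  sent to the line at infinity are arbitrary.\<close>

definition affine_expression :: "(rp2 \<Rightarrow> rp2) \<Rightarrow> complex \<Rightarrow> complex" where
  "affine_expression f z = complex_of_rp2 (f (rp2_of_complex z))"

section \<open>Eccentricity and orientation\<close>

definition partial_x :: "(complex \<Rightarrow> complex) \<Rightarrow> complex \<Rightarrow> complex" where
  "partial_x F z = frechet_derivative F (at z) 1"

definition partial_y :: "(complex \<Rightarrow> complex) \<Rightarrow> complex \<Rightarrow> complex" where
  "partial_y F z = frechet_derivative F (at z) \<i>"

definition wirtinger_z :: "(complex \<Rightarrow> complex) \<Rightarrow> complex \<Rightarrow> complex" where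
  "wirtinger_z F z = (partial_x F z - \<i> * partial_y F z) / 2"

definition wirtinger_zbar :: "(complex \<Rightarrow> complex) \<Rightarrow> complex \<Rightarrow> complex" where
  "wirtinger_zbar F z = (partial_x F z + \<i> * partial_y F z) / 2"

definition beltrami :: "(complex \<Rightarrow> complex) \<Rightarrow> complex \<Rightarrow> complex" where
  "beltrami F z = wirtinger_zbar F z / wirtinger_z F z"

definition eccentricity :: "(complex \<Rightarrow> complex) \<Rightarrow> complex \<Rightarrow> ennreal" where
  "eccentricity F z =
     (if wirtinger_z F z = 0 then \<infinity> else ennreal (norm (beltrami F z)))"

definition jacobian_det :: "(complex \<Rightarrow> complex) \<Rightarrow> complex \<Rightarrow> real" where
  "jacobian_det F z =
     Re (partial_x F z) * Im (partial_y F z) - Im (partial_x F z) * Re (partial_y F z)"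

definition orientation_preserving_on :: "complex set \<Rightarrow> (complex \<Rightarrow> complex) \<Rightarrow> bool" where
  "orientation_preserving_on S F \<longleftrightarrow>
     (\<forall>z\<in>S. F differentiable (at z) \<and> jacobian_det F z > 0)"

section \<open>Triangles and affine maps\<close>

abbreviation closed_triangle :: "complex \<Rightarrow> complex \<Rightarrow> complex \<Rightarrow> complex set" where
  "closed_triangle A B C \<equiv> convex hull {A, B, C}"

definition circumcenter :: "complex \<Rightarrow> complex \<Rightarrow> complex \<Rightarrow> complex" where
  "circumcenter A B C = (THE c. dist c A = dist c B \<and> dist c B = dist c C)"

text \<open>Only meaningful for non-collinear \<open>A\<close>, \<open>B\<close>, \<open>C\<close>, which have a unique circumcenter.\<close>

definition circumcircle :: "complex \<Rightarrow> complex \<Rightarrow> complex \<Rightarrow> complex set" where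
  "circumcircle A B C = sphere (circumcenter A B C) (dist (circumcenter A B C) A)"

definition real_affine :: "(complex \<Rightarrow> complex) \<Rightarrow> bool" where
  "real_affine h \<longleftrightarrow> (\<exists>L b. linear L \<and> (\<forall>z. h z = L z + b))"

end

theory Submission
  imports Defs
begin

text \<open>
  For an orientation preserving map the eccentricity is an increasing function of the distortion
  \<open>\<parallel>DF\<parallel>\<^sup>2 / det DF\<close> with the Hilbert--Schmidt norm (lemma \<open>eccentricity_mono_distortion\<close>), so it
  suffices to compare distortions.

  Put the origins at the circumcenters \<open>O\<^sub>1\<close>, \<open>O\<^sub>2\<close>. In the affine chart the projective map is a
  quotient \<open>n / l\<close> of a complex-valued affine function by a real-valued one. That it maps the first
  circumcircle into the second says that the quadratic polynomial \<open>\<bar>n\<bar>\<^sup>2 - R'\<^sup>2 l\<^sup>2\<close> vanishes on the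
  circle of radius \<open>R\<close>; hence it equals \<open>\<kappa> E\<close>, where \<open>E(z) = \<bar>z - O\<^sub>1\<bar>\<^sup>2 - R\<^sup>2\<close> is the power of \<open>z\<close>
  with respect to the circumcircle. Read as an identity of quadratic forms in homogeneous
  coordinates, this determines the metric pulled back by \<open>n / l\<close>, and one obtains
  \<open>\<parallel>DF\<parallel>\<^sup>2 = \<kappa> (2 l l(O\<^sub>1) + \<bar>grad l\<bar>\<^sup>2 E) / l\<^sup>4\<close>, while \<open>det DF = \<delta> / l\<^sup>3\<close> for a constant \<open>\<delta>\<close>.
  The distortion is therefore \<open>(\<kappa> / \<delta>) (2 l(O\<^sub>1) + \<bar>grad l\<bar>\<^sup>2 E / l)\<close>. Here \<open>\<kappa> > 0\<close>, orientation gives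
  \<open>\<delta> l > 0\<close> on the triangle, and \<open>E \<le> 0\<close> on the circumscribed disc with equality at the vertices.
  So the distortion is maximal at the vertices.

  It remains to see that at the vertex \<open>A\<close> the distortion is that of the affine map \<open>h\<close>. The
  derivative of the projective map at \<open>A\<close> sends the edge vectors \<open>B - A\<close>, \<open>C - A\<close> to
  \<open>s (B' - A')\<close>, \<open>t (C' - A')\<close> with \<open>s = l(B) / l(A)\<close>, \<open>t = l(C) / l(A)\<close>. Polarizing the quadratic
  identity gives \<open>l(y) l(z) \<bar>y' - z'\<bar>\<^sup>2 = \<kappa> \<bar>y - z\<bar>\<^sup>2\<close> for any two vertices \<open>y\<close>, \<open>z\<close>, so that
  \<open>s \<bar>B' - A'\<bar>\<^sup>2 \<bar>C - A\<bar>\<^sup>2 = t \<bar>C' - A'\<bar>\<^sup>2 \<bar>B - A\<bar>\<^sup>2\<close>. Under this relation both \<open>\<parallel>DF\<parallel>\<^sup>2\<close> and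
  \<open>det DF\<close> at \<open>A\<close> are \<open>s t\<close> times those of \<open>h\<close> (lemma \<open>linear_scaled_basis_distortion\<close>).
\<close>

section \<open>Circumcenters\<close>

definition cross2 :: "complex \<Rightarrow> complex \<Rightarrow> real" where
  "cross2 v w = Re v * Im w - Im v * Re w"

lemma collinear_3_if_cross2_eq_0:
  assumes "cross2 (B - A) (C - A) = 0"
  shows "collinear {A, B, C}"
proof (cases "B = A")
  case True
  then show ?thesis by (simp add: insert_commute)
next
  case False
  define e where "e = B - A"
  define g where "g = C - A"
  have "e \<noteq> 0" using False by (simp add: e_def)
  have "Re e * Im g = Im e * Re g"
    using assms by (simp add: cross2_def e_def g_def)
  have "\<exists>c. g = c *\<^sub>R e"
  proof (cases "Re e = 0")
    case True
    then have "Im e \<noteq> 0" using \<open>e \<noteq> 0\<close> by (simp add: complex_eq_iff)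
    then have "g = (Im g / Im e) *\<^sub>R e"
      using \<open>Re e * Im g = Im e * Re g\<close> True by (simp add: complex_eq_iff)
    then show ?thesis by blast
  next
    case False
    then have "g = (Re g / Re e) *\<^sub>R e"
      using \<open>Re e * Im g = Im e * Re g\<close> by (simp add: complex_eq_iff field_simps)
    then show ?thesis by blast
  qed
  then have "collinear {0, e, g}"
    by (auto simp: collinear_lemma)
  then have "collinear {B, A, C}"
    by (simp add: e_def g_def collinear_3[of B A C])
  then show ?thesis by (simp add: insert_commute)
qed

text \<open>The perpendicular bisector is a line, so equidistance is a linear condition on \<open>c\<close>; the
  circumcenter is found below by Cramer's rule.\<close>

lemma dist_eq_iff_inner:
  fixes c A B :: complex
  shows "dist c A = dist c B \<longleftrightarrow> 2 * ((c - A) \<bullet> (B - A)) = (B - A) \<bullet> (B - A)"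
proof -
  have "dist c A = dist c B \<longleftrightarrow> (dist c A)\<^sup>2 = (dist c B)\<^sup>2"
    by simp
  also have "\<dots> \<longleftrightarrow> 2 * ((c - A) \<bullet> (B - A)) = (B - A) \<bullet> (B - A)"
    by (simp add: dist_norm power2_norm_eq_inner inner_simps inner_commute algebra_simps)
  finally show ?thesis .
qed

lemma circumcenter_equidistant:
  assumes "\<not> collinear {A, B, C}"
  shows "dist (circumcenter A B C) B = dist (circumcenter A B C) A"
    and "dist (circumcenter A B C) C = dist (circumcenter A B C) A"
proof -
  define e where "e = B - A"
  define g where "g = C - A"
  define d where "d = cross2 e g"
  have "d \<noteq> 0"
    using assms collinear_3_if_cross2_eq_0 by (auto simp: d_def e_def g_def)
  have iff: "dist c A = dist c B \<and> dist c B = dist c C \<longleftrightarrow>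
      2 * ((c - A) \<bullet> e) = e \<bullet> e \<and> 2 * ((c - A) \<bullet> g) = g \<bullet> g" for c
    using dist_eq_iff_inner[of c A B] dist_eq_iff_inner[of c A C] by (auto simp: e_def g_def)
  define u where "u = Complex ((Im g * (e \<bullet> e) - Im e * (g \<bullet> g)) / (2 * d))
                              ((Re e * (g \<bullet> g) - Re g * (e \<bullet> e)) / (2 * d))"
  have eu: "2 * (u \<bullet> e) = e \<bullet> e" and gu: "2 * (u \<bullet> g) = g \<bullet> g"
    using \<open>d \<noteq> 0\<close> by (simp_all add: u_def inner_complex_def[of _ e] inner_complex_def[of _ g]
      divide_simps) (simp_all add: d_def cross2_def inner_complex_def algebra_simps)
  have uniq: "c = A + u" if "2 * ((c - A) \<bullet> e) = e \<bullet> e" "2 * ((c - A) \<bullet> g) = g \<bullet> g" for c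
  proof -
    define v where "v = c - A - u"
    have "v \<bullet> e = 0" "v \<bullet> g = 0"
      using that eu gu by (simp_all add: v_def inner_simps)
    then have "Re v * Re e + Im v * Im e = 0" "Re v * Re g + Im v * Im g = 0"
      by (simp_all add: inner_complex_def)
    then have "Re v * d = 0" "Im v * d = 0"
      unfolding d_def cross2_def by algebra+
    with \<open>d \<noteq> 0\<close> have "v = 0" by (simp add: complex_eq_iff)
    then show ?thesis by (simp add: v_def algebra_simps)
  qed
  have "\<exists>!c. dist c A = dist c B \<and> dist c B = dist c C"
    unfolding iff using eu gu uniq by (intro ex1I[of _ "A + u"]) auto
  from theI'[OF this]
  show "dist (circumcenter A B C) B = dist (circumcenter A B C) A"
    and "dist (circumcenter A B C) C = dist (circumcenter A B C) A"
    by (simp_all add: circumcenter_def)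
qed

lemma cball_vertices_contains_triangle:
  assumes "dist c B = dist c A" "dist c C = dist c A" "P \<in> closed_triangle A B C"
  shows "dist c P \<le> dist c A"
proof -
  have "closed_triangle A B C \<subseteq> cball c (dist c A)"
    using assms by (intro hull_minimal) auto
  then show ?thesis using assms by auto
qed

section \<open>Eccentricity and distortion\<close>

lemma wirtinger_norms:
  shows "(norm (wirtinger_z F z))\<^sup>2 - (norm (wirtinger_zbar F z))\<^sup>2 = jacobian_det F z"
    and "2 * ((norm (wirtinger_z F z))\<^sup>2 + (norm (wirtinger_zbar F z))\<^sup>2)
      = (norm (partial_x F z))\<^sup>2 + (norm (partial_y F z))\<^sup>2"
  by (simp_all add: wirtinger_z_def wirtinger_zbar_def jacobian_det_def norm_divide
      power_divide cmod_power2)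
    (simp_all add: power2_eq_square add_divide_distrib diff_divide_distrib algebra_simps)

definition distortion :: "(complex \<Rightarrow> complex) \<Rightarrow> complex \<Rightarrow> real" where
  "distortion F z = ((norm (partial_x F z))\<^sup>2 + (norm (partial_y F z))\<^sup>2) / jacobian_det F z"

text \<open>With \<open>a = \<bar>wirtinger_z F\<bar>\<close> and \<open>b = \<bar>wirtinger_zbar F\<bar>\<close> the distortion is
  \<open>2 (a\<^sup>2 + b\<^sup>2) / (a\<^sup>2 - b\<^sup>2)\<close>, which for \<open>a > b \<ge> 0\<close> increases with the ratio \<open>b / a\<close>.\<close>

lemma eccentricity_mono_distortion:
  assumes F: "jacobian_det F z > 0" and G: "jacobian_det G w > 0"
    and le: "distortion F z \<le> distortion G w"
  shows "eccentricity F z \<le> eccentricity G w"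
proof -
  define a b c d where "a = norm (wirtinger_z F z)" "b = norm (wirtinger_zbar F z)"
    "c = norm (wirtinger_z G w)" "d = norm (wirtinger_zbar G w)"
  note defs = this
  have ge: "a \<ge> 0" "b \<ge> 0" "c \<ge> 0" "d \<ge> 0" by (simp_all add: defs)
  have F': "jacobian_det F z = a\<^sup>2 - b\<^sup>2" "distortion F z = 2 * (a\<^sup>2 + b\<^sup>2) / (a\<^sup>2 - b\<^sup>2)"
    and G': "jacobian_det G w = c\<^sup>2 - d\<^sup>2" "distortion G w = 2 * (c\<^sup>2 + d\<^sup>2) / (c\<^sup>2 - d\<^sup>2)"
    using wirtinger_norms[of F z] wirtinger_norms[of G w]
    by (simp_all add: defs distortion_def)
  have pos: "a\<^sup>2 - b\<^sup>2 > 0" "c\<^sup>2 - d\<^sup>2 > 0" using F G F' G' by simp_all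
  have "a\<^sup>2 > 0" "c\<^sup>2 > 0"
    using pos zero_le_power2[of b] zero_le_power2[of d] by linarith+
  then have "a \<noteq> 0" "c \<noteq> 0" by auto
  with ge have ac: "a > 0" "c > 0" by auto
  have "(b * c)\<^sup>2 \<le> (d * a)\<^sup>2"
    using le pos by (simp add: F' G' divide_simps) (simp add: algebra_simps power_mult_distrib)
  then have "b * c \<le> d * a"
    using ge by (simp add: power2_le_iff_abs_le)
  then have "b / a \<le> d / c"
    using ac by (simp add: divide_simps)
  then show ?thesis
    using ac by (auto simp: eccentricity_def beltrami_def norm_divide defs intro!: ennreal_leI)
qed

lemma partials_of_derivative:
  assumes "(F has_derivative F') (at z)"
  shows "partial_x F z = F' 1" "partial_y F z = F' \<i>"
  using frechet_derivative_at[OF assms] by (simp_all add: partial_x_def partial_y_def)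

text \<open>
  Multiplied by \<open>(cross2 e g)\<^sup>2\<close>, the squared Hilbert--Schmidt norm of the linear map \<open>e \<mapsto> P\<close>, \<open>g \<mapsto> Q\<close> becomes
  \<open>\<bar>P\<bar>\<^sup>2 \<bar>g\<bar>\<^sup>2 + \<bar>Q\<bar>\<^sup>2 \<bar>e\<bar>\<^sup>2 - 2 (P \<bullet> Q) (e \<bullet> g)\<close>. The hypothesis on \<open>s\<close> and \<open>t\<close> is what makes the rescaling
  \<open>P = s e'\<close>, \<open>Q = t g'\<close> exchange the first two terms, up to the common factor \<open>s t\<close>. Here \<open>X\<close>, \<open>Y\<close> and
  \<open>U\<close>, \<open>V\<close> are the columns of the rescaled and of the original linear map.
\<close>

lemma linear_scaled_basis_distortion:
  fixes X Y U V e g e' g' :: complex and s t :: real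
  assumes "cross2 e g \<noteq> 0"
    and Xe: "Re e *\<^sub>R X + Im e *\<^sub>R Y = s *\<^sub>R e'" and Xg: "Re g *\<^sub>R X + Im g *\<^sub>R Y = t *\<^sub>R g'"
    and Ue: "Re e *\<^sub>R U + Im e *\<^sub>R V = e'" and Ug: "Re g *\<^sub>R U + Im g *\<^sub>R V = g'"
    and st: "s * ((e' \<bullet> e') * (g \<bullet> g)) = t * ((g' \<bullet> g') * (e \<bullet> e))"
  shows "cross2 X Y = s * t * cross2 U V"
    and "X \<bullet> X + Y \<bullet> Y = s * t * (U \<bullet> U + V \<bullet> V)"
proof -
  have cross: "cross2 e g * cross2 Z W = cross2 (Re e *\<^sub>R Z + Im e *\<^sub>R W) (Re g *\<^sub>R Z + Im g *\<^sub>R W)"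
    for Z W
    by (simp add: cross2_def algebra_simps)
  have sq: "(cross2 e g)\<^sup>2 * (Z \<bullet> Z + W \<bullet> W)
      = (P \<bullet> P) * (g \<bullet> g) + (Q \<bullet> Q) * (e \<bullet> e) - 2 * (P \<bullet> Q) * (e \<bullet> g)"
    if "P = Re e *\<^sub>R Z + Im e *\<^sub>R W" "Q = Re g *\<^sub>R Z + Im g *\<^sub>R W" for P Q Z W :: complex
    unfolding that cross2_def inner_complex_def plus_complex.simps scaleR_complex.simps by algebra
  have "cross2 e g * cross2 X Y = s * t * cross2 e' g'"
    using cross[of X Y] unfolding Xe Xg by (simp add: cross2_def algebra_simps)
  moreover have "cross2 e g * cross2 U V = cross2 e' g'"
    using cross[of U V] unfolding Ue Ug .
  ultimately have "cross2 e g * cross2 X Y = cross2 e g * (s * t * cross2 U V)"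
    by (simp add: mult_ac)
  then show "cross2 X Y = s * t * cross2 U V"
    using assms(1) by simp
  have "(cross2 e g)\<^sup>2 * (X \<bullet> X + Y \<bullet> Y)
      = s * (s * ((e' \<bullet> e') * (g \<bullet> g))) + t * (t * ((g' \<bullet> g') * (e \<bullet> e)))
        - 2 * s * t * (e' \<bullet> g') * (e \<bullet> g)"
    using sq[OF Xe[symmetric] Xg[symmetric]] by (simp add: algebra_simps)
  also have "\<dots> = s * (t * ((g' \<bullet> g') * (e \<bullet> e))) + t * (s * ((e' \<bullet> e') * (g \<bullet> g)))
        - 2 * s * t * (e' \<bullet> g') * (e \<bullet> g)"
    by (simp only: st)
  also have "\<dots> = (cross2 e g)\<^sup>2 * (s * t * (U \<bullet> U + V \<bullet> V))"
    using sq[OF Ue[symmetric] Ug[symmetric]] by algebra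
  finally show "X \<bullet> X + Y \<bullet> Y = s * t * (U \<bullet> U + V \<bullet> V)"
    using assms(1) by simp
qed

section \<open>Projective transformations in the affine chart\<close>

text \<open>The target is a general vector space because numerators are complex-valued and denominators
  real-valued; with \<open>r = 0\<close> this is the linear part.\<close>

definition affine_fun :: "'a::real_vector \<Rightarrow> 'a \<Rightarrow> 'a \<Rightarrow> complex \<Rightarrow> 'a" where
  "affine_fun p q r w = Re w *\<^sub>R p + Im w *\<^sub>R q + r"

text \<open>The origins \<open>O1\<close> and \<open>O2\<close> of source and target are left free so that they can later be placed
  at the circumcenters. The equivalence also covers points sent to infinity: these are the zeros of
  the denominator.\<close>

lemma affine_form_of_projective_transformation:
  fixes O1 O2 :: complex
  assumes "projective_transformation f"
  obtains p q r :: complex and a b c :: real where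
    "\<And>z w. f (rp2_of_complex z) = rp2_of_complex w \<longleftrightarrow>
      affine_fun a b c (z - O1) \<noteq> 0 \<and> affine_fun p q r (z - O1) = affine_fun a b c (z - O1) *\<^sub>R (w - O2)"
proof -
  obtain M :: "real^3^3" where inv: "invertible M"
    and M: "\<And>x. x \<noteq> 0 \<Longrightarrow> f (abs_rp2 x) = abs_rp2 (M *v x)"
    using assms by (auto simp: projective_transformation_def)
  have M0: "M *v x \<noteq> 0" if "x \<noteq> 0" for x
    using inv that by (metis invertible_def matrix_vector_mul_assoc matrix_vector_mul_lid
        matrix_vector_mult_0_right)
  define a b c where "a = M $ 3 $ 1" "b = M $ 3 $ 2" "c = M $ 3 $ 3 + Re O1 * M $ 3 $ 1 + Im O1 * M $ 3 $ 2"
  note abc = this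
  define m where "m j = Complex (M $ 1 $ j) (M $ 2 $ j)" for j
  define p q r where "p = m 1 - a *\<^sub>R O2" "q = m 2 - b *\<^sub>R O2"
    "r = m 3 + Re O1 *\<^sub>R m 1 + Im O1 *\<^sub>R m 2 - c *\<^sub>R O2"
  note pqr = this
  have "f (rp2_of_complex z) = rp2_of_complex w \<longleftrightarrow>
      affine_fun a b c (z - O1) \<noteq> 0 \<and> affine_fun p q r (z - O1) = affine_fun a b c (z - O1) *\<^sub>R (w - O2)" for z w
  proof -
    let ?x = "vector [Re z, Im z, 1] :: real^3"
    define y where "y = M *v ?x"
    have y: "y $ i = M $ i $ 1 * Re z + M $ i $ 2 * Im z + M $ i $ 3" for i
      by (simp add: y_def matrix_vector_mult_def sum_3 vector_3)
    have y3: "affine_fun a b c (z - O1) = y $ 3"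
      by (simp add: y affine_fun_def abc algebra_simps)
    have y12: "affine_fun p q r (z - O1) = Complex (y $ 1) (y $ 2) - y $ 3 *\<^sub>R O2"
      by (simp add: y affine_fun_def pqr m_def abc complex_eq_iff algebra_simps)
    have "y \<noteq> 0" using M0 by (simp add: y_def)
    have "f (rp2_of_complex z) = rp2_of_complex w \<longleftrightarrow> abs_rp2 (vector [Re w, Im w, 1]) = abs_rp2 y"
      using M[of ?x] by (auto simp: rp2_of_complex_def y_def)
    also have "\<dots> \<longleftrightarrow> (\<exists>k. k \<noteq> 0 \<and> y = k *\<^sub>R vector [Re w, Im w, 1])"
      using \<open>y \<noteq> 0\<close> by (simp add: abs_rp2_eq_iff)
    also have "\<dots> \<longleftrightarrow> y $ 3 \<noteq> 0 \<and> y $ 1 = y $ 3 * Re w \<and> y $ 2 = y $ 3 * Im w"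
      by (auto simp: vec_eq_iff forall_3 vector_3)
    also have "\<dots> \<longleftrightarrow> y $ 3 \<noteq> 0 \<and> Complex (y $ 1) (y $ 2) - y $ 3 *\<^sub>R O2 = y $ 3 *\<^sub>R (w - O2)"
      by (auto simp: complex_eq_iff algebra_simps)
    finally show ?thesis by (simp add: y3 y12)
  qed
  then show thesis by (rule that)
qed

lemma affine_expression_eqI:
  assumes "f (rp2_of_complex z) = rp2_of_complex w"
  shows "affine_expression f z = w"
  by (simp add: affine_expression_def complex_of_rp2_def assms inj_rp2_of_complex)

lemma has_derivative_affine_fun_quotient:
  fixes p q r :: complex and a b c :: real
  assumes l: "affine_fun a b c (z - O1) \<noteq> 0"
    and F: "\<And>z. affine_fun a b c (z - O1) \<noteq> 0 \<Longrightarrow> F z = O2 + affine_fun p q r (z - O1) /\<^sub>R affine_fun a b c (z - O1)"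
  shows "(F has_derivative (\<lambda>v. (affine_fun p q 0 v - affine_fun a b 0 v *\<^sub>R (F z - O2)) /\<^sub>R affine_fun a b c (z - O1))) (at z)"
proof (rule has_derivative_transform_within_open)
  let ?S = "{z. affine_fun a b c (z - O1) \<noteq> 0}"
  show "open ?S"
    unfolding affine_fun_def by (intro open_Collect_neq continuous_intros)
  show "z \<in> ?S" using l by simp
  show "\<And>x. x \<in> ?S \<Longrightarrow> O2 + affine_fun p q r (x - O1) /\<^sub>R affine_fun a b c (x - O1) = F x"
    using F by simp
  have n: "((\<lambda>x. affine_fun u v w (x - O1)) has_derivative (\<lambda>x. affine_fun u v 0 x)) (at z)"
    for u v w :: "'x::real_normed_vector"
    unfolding affine_fun_def by (auto intro!: derivative_eq_intros simp: scaleR_diff_left)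
  show "((\<lambda>x. O2 + affine_fun p q r (x - O1) /\<^sub>R affine_fun a b c (x - O1)) has_derivative
      (\<lambda>v. (affine_fun p q 0 v - affine_fun a b 0 v *\<^sub>R (F z - O2)) /\<^sub>R affine_fun a b c (z - O1))) (at z)"
    using l by (auto intro!: derivative_eq_intros n simp: F[OF l] fun_eq_iff)
      (simp add: algebra_simps divide_inverse power2_eq_square)
qed

section \<open>Circle preserving quotients of affine functions\<close>

text \<open>The four points of the circle on the axes yield everything except \<open>f = 0\<close>, for which the
  rational point \<open>(3/5, 4/5)\<close> of the unit circle is convenient.\<close>

lemma quadratic_vanishing_on_circle:
  fixes e f g d h k R :: real
  assumes R: "R > 0"
    and zero: "\<And>x y. x\<^sup>2 + y\<^sup>2 = R\<^sup>2 \<Longrightarrow> e * x\<^sup>2 + 2 * f * (x * y) + g * y\<^sup>2 + 2 * d * x + 2 * h * y + k = 0"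
  shows "g = e" "f = 0" "d = 0" "h = 0" "k = - e * R\<^sup>2"
proof -
  have 1: "e * R\<^sup>2 + 2 * d * R + k = 0" and 2: "e * R\<^sup>2 - 2 * d * R + k = 0"
    and 3: "g * R\<^sup>2 + 2 * h * R + k = 0" and 4: "g * R\<^sup>2 - 2 * h * R + k = 0"
    using zero[of R 0] zero[of "- R" 0] zero[of 0 R] zero[of 0 "- R"] by simp_all
  have "d * R = 0" "h * R = 0" using 1 2 3 4 by linarith+
  then show d: "d = 0" and h: "h = 0" using R by simp_all
  show k: "k = - e * R\<^sup>2" using 1 d by simp
  have "g * R\<^sup>2 = e * R\<^sup>2" using 3 h k by simp
  then show g: "g = e" using R by simp
  have "(3/5 * R)\<^sup>2 + (4/5 * R)\<^sup>2 = R\<^sup>2" by (simp add: power2_eq_square)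
  from zero[OF this] have "f * R\<^sup>2 = 0"
    unfolding d h k g by (simp add: power2_eq_square algebra_simps)
  then show "f = 0" using R by simp
qed

text \<open>
  The circle condition says that the quadratic polynomial \<open>\<bar>n\<bar>\<^sup>2 - R'\<^sup>2 l\<^sup>2\<close>, with \<open>n\<close> and \<open>l\<close> the two
  affine functions, vanishes on the circle, so it is a multiple \<open>\<kappa>\<close> of \<open>\<bar>w\<bar>\<^sup>2 - R\<^sup>2\<close>. Comparing
  coefficients gives more, namely the polarized identity and its versions in which one or both
  points are the points at infinity of the coordinate axes.
\<close>

lemma circle_preserving_form:
  fixes p q r :: complex and a b c R R' :: real
  assumes "R > 0"
    and circ: "\<And>w. norm w = R \<Longrightarrow> norm (affine_fun p q r w) = R' * \<bar>affine_fun a b c w\<bar>"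
  obtains \<kappa> where "\<And>v w. affine_fun p q r v \<bullet> affine_fun p q r w
      = \<kappa> * (v \<bullet> w - R\<^sup>2) + R'\<^sup>2 * (affine_fun a b c v * affine_fun a b c w)"
    and "p \<bullet> p = \<kappa> + R'\<^sup>2 * a\<^sup>2" "q \<bullet> q = \<kappa> + R'\<^sup>2 * b\<^sup>2"
    and "\<And>w. p \<bullet> affine_fun p q r w = \<kappa> * Re w + R'\<^sup>2 * (a * affine_fun a b c w)"
    and "\<And>w. q \<bullet> affine_fun p q r w = \<kappa> * Im w + R'\<^sup>2 * (b * affine_fun a b c w)"
proof -
  define \<kappa> where "\<kappa> = p \<bullet> p - R'\<^sup>2 * a\<^sup>2"
  have eq0: "(p \<bullet> p - R'\<^sup>2 * a\<^sup>2) * x\<^sup>2 + 2 * (p \<bullet> q - R'\<^sup>2 * (a * b)) * (x * y) + (q \<bullet> q - R'\<^sup>2 * b\<^sup>2) * y\<^sup>2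
      + 2 * (p \<bullet> r - R'\<^sup>2 * (a * c)) * x + 2 * (q \<bullet> r - R'\<^sup>2 * (b * c)) * y + (r \<bullet> r - R'\<^sup>2 * c\<^sup>2) = 0"
    if "x\<^sup>2 + y\<^sup>2 = R\<^sup>2" for x y
  proof -
    have "norm (Complex x y) = R" using that \<open>R > 0\<close> by (simp add: cmod_def)
    from circ[OF this] have "affine_fun p q r (Complex x y) \<bullet> affine_fun p q r (Complex x y)
        = (R' * affine_fun a b c (Complex x y))\<^sup>2"
      by (simp add: power_mult_distrib flip: power2_norm_eq_inner)
    then show ?thesis
      by (simp add: affine_fun_def inner_simps inner_commute power2_eq_square
          algebra_simps)
  qed
  note co = quadratic_vanishing_on_circle[OF \<open>R > 0\<close> eq0]
  have coeffs: "p \<bullet> p = \<kappa> + R'\<^sup>2 * a\<^sup>2" "q \<bullet> q = \<kappa> + R'\<^sup>2 * b\<^sup>2" "p \<bullet> q = R'\<^sup>2 * (a * b)"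
    "p \<bullet> r = R'\<^sup>2 * (a * c)" "q \<bullet> r = R'\<^sup>2 * (b * c)" "r \<bullet> r = - \<kappa> * R\<^sup>2 + R'\<^sup>2 * c\<^sup>2"
    using co by (simp_all add: \<kappa>_def algebra_simps)
  show thesis
  proof (rule that[of \<kappa>])
    show "affine_fun p q r v \<bullet> affine_fun p q r w
      = \<kappa> * (v \<bullet> w - R\<^sup>2) + R'\<^sup>2 * (affine_fun a b c v * affine_fun a b c w)" for v w
      by (simp add: affine_fun_def inner_simps inner_commute[of q p] inner_commute[of r p]
          inner_commute[of r q] coeffs inner_complex_def[of v] power2_eq_square algebra_simps)
    show "p \<bullet> affine_fun p q r w = \<kappa> * Re w + R'\<^sup>2 * (a * affine_fun a b c w)"
      "q \<bullet> affine_fun p q r w = \<kappa> * Im w + R'\<^sup>2 * (b * affine_fun a b c w)" for w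
      by (simp_all add: affine_fun_def inner_simps inner_commute[of q p] coeffs power2_eq_square algebra_simps)
  qed (use coeffs in simp_all)
qed

text \<open>
  The squared Hilbert--Schmidt norm of the derivative of \<open>n / l\<close> at \<open>w\<close>. Each column has squared norm
  \<open>(l\<^sup>2 (v \<bullet> v) - 2 l s (v \<bullet> n) + s\<^sup>2 (n \<bullet> n)) / l\<^sup>4\<close> for \<open>(v, s) = (p, a)\<close> or \<open>(q, b)\<close>, and after inserting the
  relations of \<open>circle_preserving_form\<close> all terms with \<open>R'\<close> cancel. What is left uses
  \<open>l - a Re w - b Im w = c\<close>, the value of the denominator at the origin.
\<close>

lemma quotient_hilbert_schmidt:
  fixes p q r :: complex and a b c R R' \<kappa> :: real
  assumes pp: "p \<bullet> p = \<kappa> + R'\<^sup>2 * a\<^sup>2" and qq: "q \<bullet> q = \<kappa> + R'\<^sup>2 * b\<^sup>2"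
    and pn: "p \<bullet> n = \<kappa> * Re w + R'\<^sup>2 * (a * l)" and qn: "q \<bullet> n = \<kappa> * Im w + R'\<^sup>2 * (b * l)"
    and nn: "n \<bullet> n = \<kappa> * (w \<bullet> w - R\<^sup>2) + R'\<^sup>2 * l\<^sup>2"
    and l: "l = affine_fun a b c w" "l \<noteq> 0"
    and X: "X = (p - a *\<^sub>R (n /\<^sub>R l)) /\<^sub>R l" and Y: "Y = (q - b *\<^sub>R (n /\<^sub>R l)) /\<^sub>R l"
  shows "X \<bullet> X + Y \<bullet> Y = \<kappa> * (2 * c * l + (a\<^sup>2 + b\<^sup>2) * (w \<bullet> w - R\<^sup>2)) / l ^ 4"
proof -
  have sq: "((v - s *\<^sub>R (n /\<^sub>R l)) /\<^sub>R l) \<bullet> ((v - s *\<^sub>R (n /\<^sub>R l)) /\<^sub>R l)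
      = (l\<^sup>2 * (v \<bullet> v) - 2 * l * s * (v \<bullet> n) + s\<^sup>2 * (n \<bullet> n)) / l ^ 4" for v s
    using l(2) by (simp add: inner_simps inner_commute[of n v] field_simps power2_eq_square power4_eq_xxxx)
  have "l\<^sup>2 * (p \<bullet> p) - 2 * l * a * (p \<bullet> n) + a\<^sup>2 * (n \<bullet> n)
      + (l\<^sup>2 * (q \<bullet> q) - 2 * l * b * (q \<bullet> n) + b\<^sup>2 * (n \<bullet> n))
      = \<kappa> * (2 * l * (l - a * Re w - b * Im w) + (a\<^sup>2 + b\<^sup>2) * (w \<bullet> w - R\<^sup>2))"
    unfolding pp qq pn qn nn by algebra
  moreover have "l - a * Re w - b * Im w = c"
    by (simp add: l affine_fun_def mult.commute)
  ultimately show ?thesis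
    unfolding X Y sq by (simp add: add_divide_distrib[symmetric] mult_ac)
qed

section \<open>Comparison with the affine map\<close>

theorem corollary4p2:
  fixes A B C A' B' C' :: complex
    and f :: "rp2 \<Rightarrow> rp2"
    and h :: "complex \<Rightarrow> complex"
  assumes "\<not> collinear {A, B, C}"
    and "\<not> collinear {A', B', C'}"
    and "projective_transformation f"
    and "f ` rp2_of_complex ` closed_triangle A B C = rp2_of_complex ` closed_triangle A' B' C'"
    and "f (rp2_of_complex A) = rp2_of_complex A'"
    and "f (rp2_of_complex B) = rp2_of_complex B'"
    and "f (rp2_of_complex C) = rp2_of_complex C'"
    and "f ` rp2_of_complex ` circumcircle A B C = rp2_of_complex ` circumcircle A' B' C'"
    and "real_affine h"
    and "h ` closed_triangle A B C = closed_triangle A' B' C'"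
    and "h A = A'" and "h B = B'" and "h C = C'"
    and "orientation_preserving_on (closed_triangle A B C) (affine_expression f)"
  shows "(\<forall>P\<in>closed_triangle A B C. eccentricity (affine_expression f) P \<le> eccentricity h P)
       \<and> (\<exists>k. (\<forall>z. eccentricity h z = k)
            \<and> (\<exists>P\<in>closed_triangle A B C. eccentricity (affine_expression f) P = k)
            \<and> (\<forall>P\<in>closed_triangle A B C. eccentricity (affine_expression f) P \<le> k))"
proof -
  let ?T = "closed_triangle A B C"
  define F where "F = affine_expression f"
  define O1 O2 where "O1 = circumcenter A B C" "O2 = circumcenter A' B' C'"
  define R R' where "R = dist O1 A" "R' = dist O2 A'"
  have AT: "A \<in> ?T" "B \<in> ?T" "C \<in> ?T" by (auto intro: hull_inc)
  have R1: "dist O1 B = R" "dist O1 C = R"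
    using circumcenter_equidistant[OF assms(1)] by (simp_all add: O1_O2_def R_R'_def)
  have R2: "dist O2 B' = R'" "dist O2 C' = R'"
    using circumcenter_equidistant[OF assms(2)] by (simp_all add: O1_O2_def R_R'_def)
  have chi: "cross2 (B - A) (C - A) \<noteq> 0"
    using assms(1) collinear_3_if_cross2_eq_0 by blast
  have "A \<noteq> B" using assms(1) by auto
  then have "R > 0" using R1 by (auto simp: R_R'_def)
  have "A' \<noteq> B'" using assms(2) by auto
  obtain p q r :: complex and a b c :: real where
    fp: "\<And>z w. f (rp2_of_complex z) = rp2_of_complex w \<longleftrightarrow>
      affine_fun a b c (z - O1) \<noteq> 0 \<and> affine_fun p q r (z - O1) = affine_fun a b c (z - O1) *\<^sub>R (w - O2)"
    by (rule affine_form_of_projective_transformation[OF assms(3), of O1 O2]) (rule that)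
  define n where "n z = affine_fun p q r (z - O1)" for z
  define l where "l z = affine_fun a b c (z - O1)" for z
  note fp' = fp[folded n_def l_def]
  have F: "F z = O2 + n z /\<^sub>R l z" if "l z \<noteq> 0" for z
    unfolding F_def using that fp' by (intro affine_expression_eqI) simp
  have lT: "l z \<noteq> 0" if "z \<in> ?T" for z
  proof -
    have "f (rp2_of_complex z) \<in> rp2_of_complex ` closed_triangle A' B' C'"
      using that assms(4) by blast
    then show ?thesis using fp' by auto
  qed
  have nA: "n A = l A *\<^sub>R (A' - O2)" "n B = l B *\<^sub>R (B' - O2)" "n C = l C *\<^sub>R (C' - O2)"
    using fp' assms(5,6,7) by blast+
  have circ: "norm (affine_fun p q r w) = R' * \<bar>affine_fun a b c w\<bar>" if "norm w = R" for w
  proof -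
    have "O1 + w \<in> circumcircle A B C"
      using that by (simp add: circumcircle_def O1_O2_def[symmetric] R_R'_def dist_norm norm_minus_commute)
    then have "f (rp2_of_complex (O1 + w)) \<in> rp2_of_complex ` circumcircle A' B' C'"
      using assms(8) by blast
    then obtain z where "f (rp2_of_complex (O1 + w)) = rp2_of_complex z" "dist O2 z = R'"
      by (auto simp: circumcircle_def O1_O2_def[symmetric] R_R'_def)
    then show ?thesis
      using fp[of "O1 + w" z] by (simp add: dist_norm norm_minus_commute mult.commute)
  qed
  obtain \<kappa> where bil: "\<And>v w. affine_fun p q r v \<bullet> affine_fun p q r w
      = \<kappa> * (v \<bullet> w - R\<^sup>2) + R'\<^sup>2 * (affine_fun a b c v * affine_fun a b c w)"
    and co: "p \<bullet> p = \<kappa> + R'\<^sup>2 * a\<^sup>2" "q \<bullet> q = \<kappa> + R'\<^sup>2 * b\<^sup>2"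
    "\<And>w. p \<bullet> affine_fun p q r w = \<kappa> * Re w + R'\<^sup>2 * (a * affine_fun a b c w)"
    "\<And>w. q \<bullet> affine_fun p q r w = \<kappa> * Im w + R'\<^sup>2 * (b * affine_fun a b c w)"
    by (rule circle_preserving_form[OF \<open>R > 0\<close> circ]) (assumption | rule that)+
  \<comment> \<open>The determinant of the matrix of the projective map in the centred coordinates.\<close>
  define \<delta> where "\<delta> = c * cross2 p q - a * cross2 r q - b * cross2 p r"
  \<comment> \<open>The power of a point with respect to the circumcircle.\<close>
  define E where "E z = (norm (z - O1))\<^sup>2 - R\<^sup>2" for z
  have deriv: "(F has_derivative (\<lambda>v. (affine_fun p q 0 v - affine_fun a b 0 v *\<^sub>R (F z - O2)) /\<^sub>R l z)) (at z)"
    if "l z \<noteq> 0" for z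
    unfolding l_def
    by (rule has_derivative_affine_fun_quotient) (use that F in \<open>auto simp: l_def n_def\<close>)
  have part: "partial_x F z = (p - a *\<^sub>R (n z /\<^sub>R l z)) /\<^sub>R l z"
     "partial_y F z = (q - b *\<^sub>R (n z /\<^sub>R l z)) /\<^sub>R l z" if "l z \<noteq> 0" for z
    using partials_of_derivative[OF deriv[OF that]] F[OF that] by (simp_all add: affine_fun_def)
  have jac: "jacobian_det F z = \<delta> / l z ^ 3" if "l z \<noteq> 0" for z
  proof -
    have "jacobian_det F z = (l z * cross2 p q - a * cross2 (n z) q - b * cross2 p (n z)) / l z ^ 3"
      using that unfolding jacobian_det_def part[OF that]
      by (simp add: cross2_def field_simps power3_eq_cube)
    also have "l z * cross2 p q - a * cross2 (n z) q - b * cross2 p (n z) = \<delta>"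
      by (simp add: l_def n_def affine_fun_def \<delta>_def cross2_def algebra_simps)
    finally show ?thesis .
  qed
  have jpos: "jacobian_det F z > 0" if "z \<in> ?T" for z
    using assms(14) that by (simp add: orientation_preserving_on_def F_def)
  \<comment> \<open>Orientation fixes the sign of the denominator on the triangle: \<open>\<delta> / l\<^sup>3\<close> is the Jacobian.\<close>
  have dl: "\<delta> * l z > 0" if "z \<in> ?T" for z
  proof -
    have "\<delta> / l z ^ 3 * (l z ^ 4) > 0"
      using jpos[OF that] jac[OF lT[OF that]] lT[OF that]
      by (intro mult_pos_pos) (simp_all add: zero_less_power_eq)
    then show ?thesis using lT[OF that] by (simp add: power3_eq_cube power4_eq_xxxx)
  qed
  have ll: "l y * l z > 0" if "y \<in> ?T" "z \<in> ?T" for y z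
    using dl[OF that(1)] dl[OF that(2)] by (auto simp: zero_less_mult_iff)
  have HS: "(norm (partial_x F z))\<^sup>2 + (norm (partial_y F z))\<^sup>2
      = \<kappa> * (2 * c * l z + (a\<^sup>2 + b\<^sup>2) * E z) / l z ^ 4" if "l z \<noteq> 0" for z
    unfolding power2_norm_eq_inner E_def
    by (rule quotient_hilbert_schmidt[OF co(1,2) co(3)[of "z - O1", folded n_def l_def]
         co(4)[of "z - O1", folded n_def l_def]
         bil[of "z - O1" "z - O1", folded n_def l_def power2_eq_square]
         l_def that part[OF that]])
  have dist: "distortion F z = \<kappa> / \<delta> * (2 * c + (a\<^sup>2 + b\<^sup>2) * E z / l z)" if "l z \<noteq> 0" "\<delta> \<noteq> 0" for z
    unfolding distortion_def HS[OF that(1)] jac[OF that(1)] using that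
    by (simp add: field_simps power3_eq_cube power4_eq_xxxx)
  \<comment> \<open>On the circumcircle the polarized form at two points is minus half their squared distance.\<close>
  have sides: "l y * l z * ((z' - y') \<bullet> (z' - y')) = \<kappa> * ((z - y) \<bullet> (z - y))"
    if "n y = l y *\<^sub>R (y' - O2)" "n z = l z *\<^sub>R (z' - O2)" "dist O1 y = R" "dist O1 z = R"
      "dist O2 y' = R'" "dist O2 z' = R'" for y z y' z'
  proof -
    have polar: "(v - u) \<bullet> (v - u) = 2 * \<rho>\<^sup>2 - 2 * ((u - w) \<bullet> (v - w))"
      if "dist w u = \<rho>" "dist w v = \<rho>" for u v w :: complex and \<rho>
    proof -
      have "(u - w) \<bullet> (u - w) = \<rho>\<^sup>2" "(v - w) \<bullet> (v - w) = \<rho>\<^sup>2"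
        using that by (simp_all add: dist_norm norm_minus_commute flip: power2_norm_eq_inner)
      then show ?thesis by (simp add: inner_simps inner_commute algebra_simps)
    qed
    have "l y * l z * ((y' - O2) \<bullet> (z' - O2))
        = \<kappa> * ((y - O1) \<bullet> (z - O1) - R\<^sup>2) + R'\<^sup>2 * (l y * l z)"
      using bil[of "y - O1" "z - O1", folded n_def l_def] by (simp add: that(1,2) mult_ac)
    then show ?thesis
      unfolding polar[OF that(3,4)] polar[OF that(5,6)] by (simp add: algebra_simps)
  qed
  have sAB: "l A * l B * ((B' - A') \<bullet> (B' - A')) = \<kappa> * ((B - A) \<bullet> (B - A))"
    and sAC: "l A * l C * ((C' - A') \<bullet> (C' - A')) = \<kappa> * ((C - A) \<bullet> (C - A))"
    using sides[OF nA(1,2)] sides[OF nA(1,3)] R1 R2 by (simp_all add: R_R'_def)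
  have "\<kappa> * ((B - A) \<bullet> (B - A)) > 0"
    unfolding sAB[symmetric] using ll[OF AT(1,2)] \<open>A' \<noteq> B'\<close> by (simp add: inner_gt_zero_iff)
  then have "\<kappa> > 0"
    by (rule zero_less_mult_pos2) (use \<open>A \<noteq> B\<close> in simp)
  have "\<delta> \<noteq> 0" using dl[OF AT(1)] by auto
  have "E A = 0" by (simp add: E_def R_R'_def dist_norm norm_minus_commute)
  \<comment> \<open>The power \<open>E\<close> is nonpositive on the disc and \<open>\<delta> l > 0\<close>, so the term with \<open>E\<close> only lowers the distortion.\<close>
  have max: "distortion F P \<le> distortion F A" if "P \<in> ?T" for P
  proof -
    have "norm (P - O1) \<le> R"
      using cball_vertices_contains_triangle[of O1 B A C P] R1 that
      by (simp add: R_R'_def dist_norm norm_minus_commute)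
    then have "E P \<le> 0" by (simp add: E_def power_mono)
    then have "\<kappa> * (a\<^sup>2 + b\<^sup>2) * E P / (\<delta> * l P) \<le> 0"
      using dl[OF that] \<open>\<kappa> > 0\<close> by (intro divide_nonpos_pos mult_nonneg_nonpos) auto
    moreover have "distortion F P = distortion F A + \<kappa> * (a\<^sup>2 + b\<^sup>2) * E P / (\<delta> * l P)"
      unfolding dist[OF lT[OF that] \<open>\<delta> \<noteq> 0\<close>] dist[OF lT[OF AT(1)] \<open>\<delta> \<noteq> 0\<close>] \<open>E A = 0\<close>
      using lT[OF that] \<open>\<delta> \<noteq> 0\<close> by (simp add: field_simps)
    ultimately show ?thesis by simp
  qed
  obtain L t where L: "linear L" and hL: "\<And>z. h z = L z + t"
    using assms(9) by (auto simp: real_affine_def)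
  have "(h has_derivative L) (at z)" for z
  proof -
    have "bounded_linear L" using L by (simp add: linear_conv_bounded_linear)
    then have "((\<lambda>z. L z + t) has_derivative L) (at z)"
      by (auto intro!: derivative_eq_intros bounded_linear_imp_has_derivative)
    then show ?thesis by (simp add: hL[abs_def])
  qed
  note parth = partials_of_derivative[OF this]
  have Lre: "Re v *\<^sub>R L 1 + Im v *\<^sub>R L \<i> = L v" for v
  proof -
    have "v = Re v *\<^sub>R 1 + Im v *\<^sub>R \<i>" by (simp add: complex_eq_iff)
    then have "L v = L (Re v *\<^sub>R 1 + Im v *\<^sub>R \<i>)" by (rule arg_cong)
    also have "\<dots> = Re v *\<^sub>R L 1 + Im v *\<^sub>R L \<i>"
      by (simp only: linear_add[OF L] linear_scale[OF L])
    finally show ?thesis by (rule sym)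
  qed
  have L1: "L (B - A) = B' - A'" "L (C - A) = C' - A'"
    using assms(11,12,13) L by (auto simp: hL linear_diff)
  \<comment> \<open>Since \<open>n\<close> and \<open>l\<close> are affine, their derivatives along an edge are the differences of the end
    values; in \<open>(n z - n A - (l z - l A) (A' - O2)) / l A\<close> the terms with \<open>l A\<close> cancel.\<close>
  have edge: "Re (z - A) *\<^sub>R partial_x F A + Im (z - A) *\<^sub>R partial_y F A = (l z / l A) *\<^sub>R (z' - A')"
    if "n z = l z *\<^sub>R (z' - O2)" for z z'
  proof -
    have "Re (z - A) *\<^sub>R partial_x F A + Im (z - A) *\<^sub>R partial_y F A
        = (n z - n A - (l z - l A) *\<^sub>R (n A /\<^sub>R l A)) /\<^sub>R l A"
      unfolding part[OF lT[OF AT(1)]]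
      by (simp add: n_def l_def affine_fun_def algebra_simps)
    then show ?thesis using lT[OF AT(1)] by (simp add: that nA algebra_simps divide_inverse)
  qed
  have st: "l B / l A * ((B' - A') \<bullet> (B' - A') * ((C - A) \<bullet> (C - A)))
      = l C / l A * ((C' - A') \<bullet> (C' - A') * ((B - A) \<bullet> (B - A)))"
  proof -
    have "l A * l B * ((B' - A') \<bullet> (B' - A')) * (\<kappa> * ((C - A) \<bullet> (C - A)))
        = l A * l C * ((C' - A') \<bullet> (C' - A')) * (\<kappa> * ((B - A) \<bullet> (B - A)))"
      unfolding sAB sAC by (rule mult.commute)
    then show ?thesis using lT[OF AT(1)] \<open>\<kappa> > 0\<close> by (simp add: field_simps)
  qed
  \<comment> \<open>The factor relating \<open>f\<close> at \<open>A\<close> to \<open>h\<close>; it cancels in the distortion and is positive because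
    the denominator has constant sign on the triangle.\<close>
  define s where "s = l B / l A * (l C / l A)"
  have "s > 0"
    using ll[OF AT(1,2)] ll[OF AT(1,3)] unfolding s_def
    by (auto simp: zero_less_mult_iff zero_less_divide_iff)
  note comp = linear_scaled_basis_distortion[OF chi edge[OF nA(2)] edge[OF nA(3)]
     Lre[of "B - A", unfolded L1] Lre[of "C - A", unfolded L1] st, folded s_def]
  have jh: "jacobian_det F A = s * jacobian_det h z" for z
    using comp(1) by (simp add: jacobian_det_def cross2_def parth)
  have jhpos: "jacobian_det h z > 0" for z
    using jh[of z] jpos[OF AT(1)] \<open>s > 0\<close> by (simp add: zero_less_mult_iff)
  have dh: "distortion h z = distortion F A" for z
    using comp(2) \<open>s > 0\<close> unfolding distortion_def jh[of z]
    by (simp add: power2_norm_eq_inner parth)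
  have le: "eccentricity F P \<le> eccentricity h z" if "P \<in> ?T" for P z
    using eccentricity_mono_distortion[OF jpos[OF that] jhpos] max[OF that] dh by simp
  have "eccentricity h z \<le> eccentricity F A" for z
    using eccentricity_mono_distortion[OF jhpos jpos[OF AT(1)]] dh by simp
  with le[OF AT(1)] have eq: "eccentricity h z = eccentricity F A" for z
    by (simp add: order_antisym)
  show ?thesis
    unfolding F_def[symmetric] using le eq AT(1) by metis
qed

end
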